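(* Let $\gamma,k_B,\omega,q_0>0$ and $T_0>T_1\ge 0$ be real constants. For a small parameter $\epsilon>0$ let $T(t)=T_0+\epsilon T_1\cos(\omega t)$. For a control $u$ (a $C^1$ function on $[0,\tfrac{2\pi}{\omega}]$ with $u(0)=u(\tfrac{2\pi}{\omega})$, extended periodically) let $\Sigma^{(0)}$ and $\Sigma^{(1)}=\Sigma^{(1)}_u$ be the $\tfrac{2\pi}{\omega}$-periodic solutions of $$\dot\Sigma^{(0)}(t)=-\frac{2q_0}{\gamma}\Sigma^{(0)}(t)+\frac{2k_BT_0}{\gamma},$$ $$\dot\Sigma^{(1)}(t)=-\frac{2q_0}{\gamma}\Sigma^{(1)}(t)-\frac{2u(t)}{\gamma}\Sigma^{(0)}(t)+\frac{2k_BT_1}{\gamma}\cos(\omega t).$$ Consider the optimal control problem $$\max_u\; -\frac{\omega}{4\pi}\int_0^{\frac{2\pi}{\omega}}\Big(\epsilon\,\dot u(t)\Sigma^{(0)}(t)+\epsilon^2\,\dot u(t)\Sigma^{(1)}_u(t)\Big)\,dt$$ over all such controls $u$. Then the maximum is attained by the optimal control law $$u^*(t)=q_1^*\cos(\omega t-\phi^* ),\qquad q_1^*=\frac{q_0\,g\,T_1}{2\gamma\omega T_0},\qquad \phi^*=\angle(\gamma\omega-i\,2q_0),\qquad g=\sqrt{\gamma^2\omega^2+4q_0^2}.$$ Moreover, with this control the power output satisfies, as $\epsilon\to0$, $$\text{power}=\epsilon^2\,\frac{k_Bq_0T_1^2}{8\gamma T_0}+O(\epsilon^3).$$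
   Context: Here $\angle z$ denotes the argument of the nonzero complex number $z$. The setting is the scalar overdamped Langevin equation $dX_t=-\frac1\gamma q(t)X_t\,dt+\sqrt{\frac{2k_BT(t)}{\gamma}}\,dB_t$ with quadratic potential $U(t,x)=\frac12 q(t)x^2$, control gain $q(t)=q_0+\epsilon u(t)$, zero-mean state, and variance $\Sigma(t)=\mathbb E[X_t^2]$. The variance obeys $\dot\Sigma(t)=-\frac{2}{\gamma}q(t)\Sigma(t)+\frac{2}{\gamma}k_BT(t)$, and the process is cyclic, i.e. $\Sigma$ is the $\frac{2\pi}{\omega}$-periodic solution of this equation. The functions $\Sigma^{(0)},\Sigma^{(1)}$ are the zeroth- and first-order coefficients in the expansion $\Sigma=\sum_{k\ge0}\epsilon^k\Sigma^{(k)}$. The power output of a control $u$ is the average extracted work per unit time over a cycle, $$\text{power}=-\frac{\omega}{4\pi}\int_0^{\frac{2\pi}{\omega}}\epsilon\,\dot u(t)\,\Sigma(t)\,dt,$$ where $\Sigma$ is the exact periodic variance for $q=q_0+\epsilon u$. *)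

theory Defs
  imports "HOL-Analysis.Analysis" "HOL-Library.Landau_Symbols"
begin

definition is_periodic_solution ::
    "real \<Rightarrow> (real \<Rightarrow> real \<Rightarrow> real) \<Rightarrow> (real \<Rightarrow> real) \<Rightarrow> bool" where
  "is_periodic_solution P F S \<longleftrightarrow>
     (\<forall>t. (S has_real_derivative F t (S t)) (at t)) \<and> (\<forall>t. S (t + P) = S t)"

(* For a scalar linear equation S' = -a(t) S + b(t) with continuous P-periodic a, b and
   nonzero integral of a over one period there is exactly one P-periodic solution, so THE
   denotes it in each use below. *)
definition periodic_solution :: "real \<Rightarrow> (real \<Rightarrow> real \<Rightarrow> real) \<Rightarrow> real \<Rightarrow> real" where
  "periodic_solution P F = (THE S. is_periodic_solution P F S)"

(* A control is represented by its periodic extension to the real line. Derivatives are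
   taken within one closed period, so the extension may have a corner at multiples of the
   period; u(0) = u(2 pi / omega) is an instance of periodicity. *)
definition is_control :: "real \<Rightarrow> (real \<Rightarrow> real) \<Rightarrow> bool" where
  "is_control \<omega> u \<longleftrightarrow>
     (\<forall>t. u (t + 2 * pi / \<omega>) = u t) \<and>
     (\<exists>u'. continuous_on {0..2 * pi / \<omega>} u' \<and>
           (\<forall>t\<in>{0..2 * pi / \<omega>}.
              (u has_vector_derivative u' t) (at t within {0..2 * pi / \<omega>})))"

definition control_deriv :: "real \<Rightarrow> (real \<Rightarrow> real) \<Rightarrow> real \<Rightarrow> real" where
  "control_deriv \<omega> u t = vector_derivative u (at t within {0..2 * pi / \<omega>})"

definition Sigma0 :: "real \<Rightarrow> real \<Rightarrow> real \<Rightarrow> real \<Rightarrow> real \<Rightarrow> real \<Rightarrow> real" where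
  "Sigma0 \<gamma> kB \<omega> q0 T0 =
     periodic_solution (2 * pi / \<omega>)
       (\<lambda>t s. - (2 * q0 / \<gamma>) * s + 2 * kB * T0 / \<gamma>)"

definition Sigma1 ::
    "real \<Rightarrow> real \<Rightarrow> real \<Rightarrow> real \<Rightarrow> real \<Rightarrow> real \<Rightarrow> (real \<Rightarrow> real) \<Rightarrow> real \<Rightarrow> real" where
  "Sigma1 \<gamma> kB \<omega> q0 T0 T1 u =
     periodic_solution (2 * pi / \<omega>)
       (\<lambda>t s. - (2 * q0 / \<gamma>) * s - (2 * u t / \<gamma>) * Sigma0 \<gamma> kB \<omega> q0 T0 t
              + (2 * kB * T1 / \<gamma>) * cos (\<omega> * t))"

definition objective ::
    "real \<Rightarrow> real \<Rightarrow> real \<Rightarrow> real \<Rightarrow> real \<Rightarrow> real \<Rightarrow> real \<Rightarrow> (real \<Rightarrow> real) \<Rightarrow> real" where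
  "objective \<gamma> kB \<omega> q0 T0 T1 \<epsilon> u =
     - (\<omega> / (4 * pi)) *
       integral {0..2 * pi / \<omega>}
         (\<lambda>t. \<epsilon> * control_deriv \<omega> u t * Sigma0 \<gamma> kB \<omega> q0 T0 t
              + \<epsilon>\<^sup>2 * control_deriv \<omega> u t * Sigma1 \<gamma> kB \<omega> q0 T0 T1 u t)"

definition temperature :: "real \<Rightarrow> real \<Rightarrow> real \<Rightarrow> real \<Rightarrow> real \<Rightarrow> real" where
  "temperature \<omega> T0 T1 \<epsilon> t = T0 + \<epsilon> * T1 * cos (\<omega> * t)"

definition variance_cyclic ::
    "real \<Rightarrow> real \<Rightarrow> real \<Rightarrow> real \<Rightarrow> real \<Rightarrow> real \<Rightarrow> real \<Rightarrow> (real \<Rightarrow> real) \<Rightarrow> real \<Rightarrow> real" where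
  "variance_cyclic \<gamma> kB \<omega> q0 T0 T1 \<epsilon> u =
     periodic_solution (2 * pi / \<omega>)
       (\<lambda>t s. - (2 / \<gamma>) * (q0 + \<epsilon> * u t) * s
              + (2 / \<gamma>) * kB * temperature \<omega> T0 T1 \<epsilon> t)"

definition power_output ::
    "real \<Rightarrow> real \<Rightarrow> real \<Rightarrow> real \<Rightarrow> real \<Rightarrow> real \<Rightarrow> real \<Rightarrow> (real \<Rightarrow> real) \<Rightarrow> real" where
  "power_output \<gamma> kB \<omega> q0 T0 T1 \<epsilon> u =
     - (\<omega> / (4 * pi)) *
       integral {0..2 * pi / \<omega>}
         (\<lambda>t. \<epsilon> * control_deriv \<omega> u t * variance_cyclic \<gamma> kB \<omega> q0 T0 T1 \<epsilon> u t)"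

end

theory Submission
  imports Defs "HOL-Library.Periodic_Fun"
begin

text \<open>
  Write \<open>a = 2 q0 / \<gamma>\<close>, \<open>b = 2 k\<^sub>B T0 / (\<gamma> q0)\<close>, \<open>c = 2 k\<^sub>B T1 / \<gamma>\<close>. The zeroth-order variance
  is constant, so only the \<open>\<epsilon>\<^sup>2\<close>-part of the objective depends on the control. If \<open>h\<close> is a
  perturbation of \<open>u*\<close> and \<open>v\<close> the resulting perturbation of \<open>\<Sigma>\<^sup>(\<^sup>1\<^sup>)\<close>, then \<open>v' = - a v - b h\<close>,
  and substituting \<open>h = - (v' + a v) / b\<close> shows that, up to total derivatives of periodic
  functions, \<open>h' v\<close> equals \<open>v'\<^sup>2 / b\<close>, while the first variation vanishes exactly if
  \<open>\<Sigma>\<^sup>(\<^sup>1\<^sup>)'' = a \<Sigma>\<^sup>(\<^sup>1\<^sup>)' + b u*'\<close>. Together with the equation for \<open>\<Sigma>\<^sup>(\<^sup>1\<^sup>)\<close> this gives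
  \<open>\<Sigma>\<^sup>(\<^sup>1\<^sup>) = c / (2 \<omega>) sin \<omega>t\<close> and hence \<open>u*\<close>. The power asymptotics follow because the remainder
  \<open>\<Sigma> - \<Sigma>\<^sup>(\<^sup>0\<^sup>) - \<epsilon> \<Sigma>\<^sup>(\<^sup>1\<^sup>)\<close> solves a linear equation with forcing \<open>O(\<epsilon>\<^sup>2)\<close>; at a maximum of its
  modulus the derivative vanishes, which bounds it by the forcing.
\<close>

section \<open>Periodic solutions of scalar linear equations\<close>

lemma antiderivative_exists_UNIV:
  fixes f :: "real \<Rightarrow> real"
  assumes "continuous_on UNIV f"
  obtains F where "\<And>t. (F has_real_derivative f t) (at t)"
proof -
  have "isCont f x" for x
    using assms by (simp add: continuous_on_eq_continuous_at)
  then obtain F where "\<And>x. (F has_vector_derivative f x) (at x)"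
    using einterval_antiderivative[of "-\<infinity>" "\<infinity>" f] by auto
  then show thesis
    using that by (auto simp: has_real_derivative_iff_has_vector_derivative)
qed

lemma has_real_derivative_imp_continuous_on:
  assumes "\<And>t. (f has_real_derivative f' t) (at t)"
  shows "continuous_on A f"
  by (rule DERIV_continuous_on[where D = f']) (rule assms[THEN has_field_derivative_at_within])

text \<open>With \<open>A' = \<alpha>\<close>, the integrating factor \<open>exp A\<close> turns the
  equation into an integration and makes homogeneous solutions multiples of
  \<open>exp (- A t)\<close>. Positivity of \<open>\<alpha>\<close> gives \<open>A 0 < A P\<close>,
  so no nonzero homogeneous solution is periodic, and the same inequality makes the periodicity
  condition solvable for the integration constant.\<close>

lemma ex1_periodic_solution_linear:
  fixes \<alpha> \<beta> :: "real \<Rightarrow> real"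
  assumes P: "P > 0"
    and cont: "continuous_on UNIV \<alpha>" "continuous_on UNIV \<beta>"
    and per: "\<And>t. \<alpha> (t + P) = \<alpha> t" "\<And>t. \<beta> (t + P) = \<beta> t"
    and pos: "\<And>t. \<alpha> t > 0"
  shows "\<exists>!S. is_periodic_solution P (\<lambda>t s. - \<alpha> t * s + \<beta> t) S"
proof -
  obtain A where A: "\<And>t. (A has_real_derivative \<alpha> t) (at t)"
    using antiderivative_exists_UNIV[OF cont(1)] by metis
  have contA: "continuous_on UNIV A"
    using A by (rule has_real_derivative_imp_continuous_on)
  obtain B where B: "\<And>t. (B has_real_derivative exp (A t) * \<beta> t) (at t)"
    using antiderivative_exists_UNIV[of "\<lambda>t. exp (A t) * \<beta> t"] contA cont(2)
    by (metis continuous_on_mult continuous_on_exp)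
  have AP: "A 0 < A P"
    using DERIV_pos_imp_increasing[OF P] A pos by blast
  have hom: "D t * exp (A t) = D 0 * exp (A 0)"
    if "\<And>t. (D has_real_derivative - \<alpha> t * D t) (at t)" for D t
  proof -
    have "((\<lambda>t. D t * exp (A t)) has_real_derivative 0) (at x)" for x
      by (auto intro!: derivative_eq_intros that A)
    then show ?thesis
      using DERIV_isconst_all[of "\<lambda>t. D t * exp (A t)" t 0] by simp
  qed
  have diff: "((\<lambda>t. S t - S' t) has_real_derivative - \<alpha> t * (S t - S' t)) (at t)"
    if "\<And>t. (S has_real_derivative - \<alpha> t * S t + \<beta> t) (at t)"
       "\<And>t. (S' has_real_derivative - \<alpha> t * S' t + \<beta> t) (at t)" for S S' t
    by (auto intro!: derivative_eq_intros that simp: algebra_simps)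
  \<comment> \<open>\<open>C\<close> is the integration constant obtained by solving
    \<open>S P = S 0\<close> for it.\<close>
  define C where "C = (exp (- A P) * B P - exp (- A 0) * B 0) / (exp (- A 0) - exp (- A P))"
  define S where "S t = exp (- A t) * (C + B t)" for t
  have S: "(S has_real_derivative - \<alpha> t * S t + \<beta> t) (at t)" for t
    unfolding S_def
    by (auto intro!: derivative_eq_intros A B simp: algebra_simps exp_minus)
  have "exp (- A 0) - exp (- A P) \<noteq> 0" using AP by simp
  then have SP: "S P = S 0"
    unfolding S_def C_def by (simp add: field_simps)
  have shift: "((\<lambda>t. S (t + P)) has_real_derivative - \<alpha> t * S (t + P) + \<beta> t) (at t)" for t
    using S[of "t + P"] per by (simp add: DERIV_shift)
  \<comment> \<open>The translate of \<open>S\<close> solves the same equation, so its difference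
    from \<open>S\<close> is a homogeneous solution; it vanishes at 0 and therefore
    everywhere.\<close>
  have "S (t + P) = S t" for t
    using hom[OF diff[OF shift S], of t] SP by simp
  then have ex: "is_periodic_solution P (\<lambda>t s. - \<alpha> t * s + \<beta> t) S"
    unfolding is_periodic_solution_def using S by blast
  show ?thesis
  proof (rule ex1I, rule ex)
    fix R assume R: "is_periodic_solution P (\<lambda>t s. - \<alpha> t * s + \<beta> t) R"
    define D where "D t = R t - S t" for t
    have D: "D t * exp (A t) = D 0 * exp (A 0)" for t
      unfolding D_def using R S
      by (intro hom[OF diff]) (auto simp: is_periodic_solution_def)
    have "D P = D 0"
      using R ex unfolding D_def is_periodic_solution_def by (metis add_0)
    then have "D 0 = 0" using D[of P] AP by auto
    then have "D t = 0" for t using D[of t] by simp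
    then show "R = S" unfolding D_def by auto
  qed
qed

text \<open>Replaces the definite description by two usable facts. Keeping \<open>F\<close> as a
  variable with an equation lets the right-hand side be used in whatever form it comes.\<close>

lemma periodic_solution_linear:
  fixes \<alpha> \<beta> :: "real \<Rightarrow> real"
  assumes "P > 0" "continuous_on UNIV \<alpha>" "continuous_on UNIV \<beta>"
    and "\<And>t. \<alpha> (t + P) = \<alpha> t" "\<And>t. \<beta> (t + P) = \<beta> t" "\<And>t. \<alpha> t > 0"
    and F: "F = (\<lambda>t s. - \<alpha> t * s + \<beta> t)"
  shows "is_periodic_solution P F (periodic_solution P F)"
    and "is_periodic_solution P F S \<Longrightarrow> periodic_solution P F = S"
proof -
  have "\<exists>!S. is_periodic_solution P F S"
    unfolding F by (rule ex1_periodic_solution_linear) (use assms in auto)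
  then show "is_periodic_solution P F (periodic_solution P F)"
    and "is_periodic_solution P F S \<Longrightarrow> periodic_solution P F = S"
    unfolding periodic_solution_def by (rule theI', rule the1_equality)
qed

section \<open>Continuity, maxima and a priori bounds for periodic functions\<close>

lemma periodic_continuous_on_UNIV:
  fixes f :: "real \<Rightarrow> 'a::topological_space"
  assumes P: "P > 0" and per: "\<And>t. f (t + P) = f t" and cont: "continuous_on {0..P} f"
  shows "continuous_on UNIV f"
proof -
  interpret periodic_fun_simple f P by unfold_locales (rule per)
  have block: "continuous_on {of_int n * P..(of_int n + 1) * P} f" for n :: int
  proof -
    have "continuous_on {of_int n * P..(of_int n + 1) * P} (\<lambda>t. f (t - of_int n * P))"
      by (rule continuous_on_compose2[OF cont])
         (auto intro!: continuous_intros simp: algebra_simps)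
    then show ?thesis by (simp add: minus_of_int)
  qed
  have "isCont f t" for t
  proof -
    define n where "n = \<lfloor>t / P\<rfloor>"
    have n: "of_int n * P \<le> t" "t < (of_int n + 1) * P"
      unfolding n_def using floor_divide_lower[OF P] floor_divide_upper[OF P] by auto
    have "continuous_on ({of_int (n - 1) * P..of_int n * P} \<union> {of_int n * P..(of_int n + 1) * P}) f"
      using block[of "n - 1"] block[of n] by (intro continuous_on_closed_Un) auto
    then have "continuous_on {of_int (n - 1) * P<..<(of_int n + 1) * P} f"
      by (rule continuous_on_subset) auto
    moreover have "t \<in> {of_int (n - 1) * P<..<(of_int n + 1) * P}"
      using n P by (auto simp: algebra_simps)
    ultimately show ?thesis
      by (simp add: continuous_on_eq_continuous_at)
  qed
  then show ?thesis by (simp add: continuous_on_eq_continuous_at)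
qed

lemma periodic_attains_sup:
  fixes f :: "real \<Rightarrow> real"
  assumes P: "P > 0" and per: "\<And>t. f (t + P) = f t" and cont: "continuous_on {0..P} f"
  obtains t0 where "\<And>t. f t \<le> f t0"
proof -
  interpret periodic_fun_simple f P by unfold_locales (rule per)
  obtain t0 where "\<forall>t\<in>{0..P}. f t \<le> f t0"
    using continuous_attains_sup[of "{0..P}" f] cont P by force
  then have t0: "t \<in> {0..P} \<Longrightarrow> f t \<le> f t0" for t by blast
  have "f t \<le> f t0" for t
  proof -
    have "f (t - of_int \<lfloor>t / P\<rfloor> * P) \<le> f t0"
      using P floor_divide_lower[OF P, of t] floor_divide_upper[OF P, of t]
      by (intro t0) (auto simp: algebra_simps)
    then show ?thesis by (simp add: minus_of_int)
  qed
  then show thesis using that by blast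
qed

text \<open>The maximum is taken of the square of \<open>R\<close>, which unlike the modulus is
  differentiable at zeros of \<open>R\<close>. At the maximiser either \<open>R\<close> vanishes or
  \<open>\<alpha> * R = r\<close>.\<close>

lemma periodic_linear_ode_bound:
  fixes R :: "real \<Rightarrow> real"
  assumes P: "P > 0" and m: "m > 0"
    and der: "\<And>t. (R has_real_derivative - \<alpha> t * R t + r t) (at t)"
    and per: "\<And>t. R (t + P) = R t"
    and \<alpha>: "\<And>t. \<alpha> t \<ge> m" and r: "\<And>t. \<bar>r t\<bar> \<le> M"
  shows "\<bar>R t\<bar> \<le> M / m"
proof -
  have "continuous_on {0..P} R"
    using der by (rule has_real_derivative_imp_continuous_on)
  then obtain t0 where t0: "\<And>t. (R t)\<^sup>2 \<le> (R t0)\<^sup>2"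
    using periodic_attains_sup[OF P, of "\<lambda>t. (R t)\<^sup>2"] per
    by (metis continuous_on_power)
  have "((\<lambda>t. (R t)\<^sup>2) has_real_derivative 2 * R t0 * (- \<alpha> t0 * R t0 + r t0)) (at t0)"
    by (auto intro!: derivative_eq_intros der)
  then have "2 * R t0 * (- \<alpha> t0 * R t0 + r t0) = 0"
    by (rule DERIV_local_max[of _ _ _ 1]) (use t0 in auto)
  then have "R t0 = 0 \<or> \<alpha> t0 * R t0 = r t0" by auto
  then have "\<bar>R t0\<bar> * m \<le> M"
  proof
    assume "R t0 = 0" then show ?thesis using r[of t0] by auto
  next
    assume eq: "\<alpha> t0 * R t0 = r t0"
    have "\<bar>R t0\<bar> * m \<le> \<bar>R t0\<bar> * \<alpha> t0"
      using \<alpha> by (intro mult_left_mono) auto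
    also have "\<dots> = \<bar>r t0\<bar>"
      using \<alpha>[of t0] m unfolding eq[symmetric] by (simp add: abs_mult)
    finally show ?thesis using r[of t0] by simp
  qed
  then have "\<bar>R t0\<bar> \<le> M / m" using m by (simp add: field_simps)
  then show ?thesis using t0[of t] abs_le_square_iff[of "R t" "R t0"] by linarith
qed

section \<open>Minimality of the work integral at a stationary response\<close>

text \<open>The excess of the integrand at \<open>u\<close> over that at \<open>w\<close> is a
  square divided by \<open>b\<close> plus the derivative of a function with equal end values. The
  hypothesis \<open>stationary\<close> is the Euler-Lagrange equation: it removes the terms linear
  in the perturbation. The work integral enters the objective with a negative factor, so a minimum
  is what is wanted.\<close>

lemma linear_response_work_minimal:
  fixes u u' w w' S S0 D0 f :: "real \<Rightarrow> real"
  assumes P: "P > 0" and b: "b > 0"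
    and u: "\<And>t. t \<in> {0..P} \<Longrightarrow> (u has_real_derivative u' t) (at t within {0..P})"
    and w: "\<And>t. (w has_real_derivative w' t) (at t)"
    and cw': "continuous_on UNIV w'"
    and S: "\<And>t. (S has_real_derivative - a * S t - b * u t + f t) (at t)"
    and S0: "\<And>t. (S0 has_real_derivative D0 t) (at t)"
    and D0: "\<And>t. D0 t = - a * S0 t - b * w t + f t"
    and stationary: "\<And>t. (D0 has_real_derivative a * D0 t + b * w' t) (at t)"
    and per: "u P = u 0" "w P = w 0" "S P = S 0" "S0 P = S0 0" "D0 P = D0 0"
  shows "integral {0..P} (\<lambda>t. w' t * S0 t) \<le> integral {0..P} (\<lambda>t. u' t * S t)"
proof -
  define h v v' where "h t = u t - w t" and "v t = S t - S0 t" and "v' t = - a * v t - b * h t" for t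
  have h: "(h has_real_derivative u' t - w' t) (at t within {0..P})" if "t \<in> {0..P}" for t
    unfolding h_def using that
    by (auto intro!: derivative_eq_intros u w[THEN has_field_derivative_at_within])
  have v: "(v has_real_derivative v' t) (at t)" for t
    unfolding v_def v'_def h_def
    by (auto intro!: derivative_eq_intros S S0 simp: D0 algebra_simps)
  note within = has_field_derivative_at_within
  \<comment> \<open>After substituting \<open>h = - (v' + a * v) / b\<close>, the first two terms
    have derivative \<open>h' * v - v'^2 / b\<close>, the quadratic part; the last two have
    derivative \<open>h' * S0 + w' * v\<close>, the first variation.\<close>
  define G where "G t = h t * v t + a / (2 * b) * (v t)\<^sup>2 + h t * S0 t + v t * D0 t / b" for t
  have G: "(G has_real_derivative u' t * S t - w' t * S0 t - (v' t)\<^sup>2 / b) (at t within {0..P})"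
    if t: "t \<in> {0..P}" for t
  proof -
    have "(G has_real_derivative
        ((u' t - w' t) * v t + v' t * h t) + a / (2 * b) * (2 * v t * v' t)
          + ((u' t - w' t) * S0 t + D0 t * h t)
          + (v' t * D0 t + (a * D0 t + b * w' t) * v t) / b) (at t within {0..P})"
      unfolding G_def using b
      by (auto intro!: derivative_eq_intros h[OF t] within[OF v] within[OF S0]
            within[OF stationary])
    also have "((u' t - w' t) * v t + v' t * h t) + a / (2 * b) * (2 * v t * v' t)
          + ((u' t - w' t) * S0 t + D0 t * h t)
          + (v' t * D0 t + (a * D0 t + b * w' t) * v t) / b
        = u' t * S t - w' t * S0 t - (v' t)\<^sup>2 / b"
    proof -
      have "S t = S0 t + v t" by (simp add: v_def)
      then show ?thesis using b
        by (simp add: v'_def field_simps power2_eq_square)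
    qed
    finally show ?thesis .
  qed
  have "G P = G 0" unfolding G_def h_def v_def using per by simp
  then have intG: "((\<lambda>t. u' t * S t - w' t * S0 t - (v' t)\<^sup>2 / b) has_integral 0) {0..P}"
    using fundamental_theorem_of_calculus[of 0 P G] G P
    by (simp add: has_real_derivative_iff_has_vector_derivative)
  have "continuous_on {0..P} S0"
    using S0 by (rule has_real_derivative_imp_continuous_on)
  then have int0: "(\<lambda>t. w' t * S0 t) integrable_on {0..P}"
    by (intro integrable_continuous_real continuous_intros continuous_on_subset[OF cw']) auto
  have "continuous_on {0..P} v" "continuous_on {0..P} h"
    using has_real_derivative_imp_continuous_on[OF v] DERIV_continuous_on[OF h] by auto
  then have intv: "(\<lambda>t. (v' t)\<^sup>2 / b) integrable_on {0..P}"
    unfolding v'_def using b by (intro integrable_continuous_real continuous_intros) auto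
  \<comment> \<open>Adding back two integrable terms recovers \<open>u' t * S t\<close>, so its
    integrability comes from the fundamental theorem rather than from regularity of
    \<open>u'\<close>.\<close>
  have "((\<lambda>t. (u' t * S t - w' t * S0 t - (v' t)\<^sup>2 / b) + (w' t * S0 t + (v' t)\<^sup>2 / b)) has_integral
      0 + (integral {0..P} (\<lambda>t. w' t * S0 t) + integral {0..P} (\<lambda>t. (v' t)\<^sup>2 / b))) {0..P}"
    by (intro has_integral_add intG integrable_integral int0 intv)
  then have "integral {0..P} (\<lambda>t. u' t * S t)
      = integral {0..P} (\<lambda>t. w' t * S0 t) + integral {0..P} (\<lambda>t. (v' t)\<^sup>2 / b)"
    by (simp add: integral_unique)
  moreover have "integral {0..P} (\<lambda>t. (v' t)\<^sup>2 / b) \<ge> 0"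
    using b by (intro integral_nonneg intv) auto
  ultimately show ?thesis by simp
qed

section \<open>Variance coefficients, controls and the reduced objective\<close>

lemma Sigma0_eq:
  assumes "\<gamma> > 0" "\<omega> > 0" "q0 > 0"
  shows "Sigma0 \<gamma> kB \<omega> q0 T0 = (\<lambda>t. kB * T0 / q0)"
proof -
  have "2 * pi / \<omega> > 0" "2 * q0 / \<gamma> > 0" using assms by simp_all
  note lin = periodic_solution_linear(2)[OF this(1) continuous_on_const continuous_on_const
      refl refl this(2) refl]
  show ?thesis
    unfolding Sigma0_def
  proof (rule lin)
    have "- (2 * q0 / \<gamma>) * (kB * T0 / q0) + 2 * kB * T0 / \<gamma> = 0"
      using assms by (simp add: field_simps)
    then show "is_periodic_solution (2 * pi / \<omega>)
        (\<lambda>t s. - (2 * q0 / \<gamma>) * s + 2 * kB * T0 / \<gamma>) (\<lambda>t. kB * T0 / q0)"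
      unfolding is_periodic_solution_def by (simp only: DERIV_const simp_thms)
  qed
qed

lemma cos_period_shift:
  assumes "\<omega> \<noteq> (0::real)"
  shows "cos (\<omega> * (t + 2 * pi / \<omega>)) = cos (\<omega> * t)" "sin (\<omega> * (t + 2 * pi / \<omega>)) = sin (\<omega> * t)"
  using assms by (simp_all add: distrib_left)

text \<open>Substituting the constant zeroth-order variance separates the coefficient of
  \<open>s\<close> from the forcing, the shape required for existence and uniqueness.\<close>

lemma Sigma1_linear_form:
  assumes "\<gamma> > 0" "\<omega> > 0" "q0 > 0"
  shows "(\<lambda>t s. - (2 * q0 / \<gamma>) * s - (2 * u t / \<gamma>) * Sigma0 \<gamma> kB \<omega> q0 T0 t
              + (2 * kB * T1 / \<gamma>) * cos (\<omega> * t))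
       = (\<lambda>t s. - (2 * q0 / \<gamma>) * s + (- (2 * kB * T0 / (\<gamma> * q0)) * u t + (2 * kB * T1 / \<gamma>) * cos (\<omega> * t)))"
  using assms by (intro ext) (simp add: Sigma0_eq field_simps)

lemma is_controlI:
  assumes per: "\<And>t. u (t + 2 * pi / \<omega>) = u t"
    and der: "\<And>t. (u has_real_derivative d t) (at t)" and cont: "continuous_on UNIV d"
  shows "is_control \<omega> u"
proof -
  have "(u has_vector_derivative d t) (at t within A)" for t A
    using der[of t] has_vector_derivative_at_within
    unfolding has_real_derivative_iff_has_vector_derivative by blast
  moreover have "continuous_on {0..2 * pi / \<omega>} d"
    using cont continuous_on_subset subset_UNIV by blast
  ultimately show ?thesis
    unfolding is_control_def using per by blast
qed

lemma is_control_periodic: "is_control \<omega> u \<Longrightarrow> u (t + 2 * pi / \<omega>) = u t"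
  unfolding is_control_def by blast

text \<open>Differentiability is known only within one closed period; gluing periods gives
  continuity on the whole line, where the variance equations are posed.\<close>

lemma is_control_continuous:
  assumes "\<omega> > 0" "is_control \<omega> u"
  shows "continuous_on UNIV u"
proof (rule periodic_continuous_on_UNIV)
  show "continuous_on {0..2 * pi / \<omega>} u"
    using assms(2) unfolding is_control_def
    by (meson continuous_on_eq_continuous_within has_vector_derivative_continuous)
  show "u (t + 2 * pi / \<omega>) = u t" for t using assms(2) by (rule is_control_periodic)
qed (use assms(1) in simp)

lemma Sigma1_solution:
  assumes pos: "\<gamma> > 0" "\<omega> > 0" "q0 > 0" and u: "is_control \<omega> u"
    and F: "F = (\<lambda>t s. - (2 * q0 / \<gamma>) * s
      + (- (2 * kB * T0 / (\<gamma> * q0)) * u t + (2 * kB * T1 / \<gamma>) * cos (\<omega> * t)))"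
  shows "is_periodic_solution (2 * pi / \<omega>) F (Sigma1 \<gamma> kB \<omega> q0 T0 T1 u)"
    and "is_periodic_solution (2 * pi / \<omega>) F S \<Longrightarrow> Sigma1 \<gamma> kB \<omega> q0 T0 T1 u = S"
proof -
  let ?\<beta> = "\<lambda>t. - (2 * kB * T0 / (\<gamma> * q0)) * u t + (2 * kB * T1 / \<gamma>) * cos (\<omega> * t)"
  have Sigma1: "Sigma1 \<gamma> kB \<omega> q0 T0 T1 u = periodic_solution (2 * pi / \<omega>) F"
    unfolding Sigma1_def Sigma1_linear_form[OF pos] F ..
  have P: "2 * pi / \<omega> > 0" and a: "2 * q0 / \<gamma> > 0" using pos by simp_all
  have cont: "continuous_on UNIV ?\<beta>"
    by (intro continuous_intros is_control_continuous[OF pos(2) u])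
  have per: "?\<beta> (t + 2 * pi / \<omega>) = ?\<beta> t" for t
    using pos by (simp add: cos_period_shift is_control_periodic[OF u])
  note lin = periodic_solution_linear[OF P continuous_on_const cont refl per a F]
  show "is_periodic_solution (2 * pi / \<omega>) F (Sigma1 \<gamma> kB \<omega> q0 T0 T1 u)"
    unfolding Sigma1 by (rule lin(1))
  show "is_periodic_solution (2 * pi / \<omega>) F S \<Longrightarrow> Sigma1 \<gamma> kB \<omega> q0 T0 T1 u = S"
    unfolding Sigma1 by (rule lin(2))
qed

lemma Sigma1_ode:
  assumes "\<gamma> > 0" "\<omega> > 0" "q0 > 0" "is_control \<omega> u"
  shows "(Sigma1 \<gamma> kB \<omega> q0 T0 T1 u has_real_derivative
      - (2 * q0 / \<gamma>) * Sigma1 \<gamma> kB \<omega> q0 T0 T1 u t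
        + (- (2 * kB * T0 / (\<gamma> * q0)) * u t + (2 * kB * T1 / \<gamma>) * cos (\<omega> * t))) (at t)"
    and "Sigma1 \<gamma> kB \<omega> q0 T0 T1 u (t + 2 * pi / \<omega>) = Sigma1 \<gamma> kB \<omega> q0 T0 T1 u t"
  using Sigma1_solution(1)[OF assms refl, of kB T0 T1]
  unfolding is_periodic_solution_def by simp_all

text \<open>Positive \<open>\<omega>\<close> makes the period interval nondegenerate, so derivatives
  within it are unique even at the end points.\<close>

lemma control_deriv_eq:
  assumes "\<omega> > 0" "t \<in> {0..2 * pi / \<omega>}"
    and "(u has_vector_derivative d) (at t within {0..2 * pi / \<omega>})"
  shows "control_deriv \<omega> u t = d"
  unfolding control_deriv_def
  by (rule vector_derivative_within_closed_interval[OF _ assms(2,3)]) (use assms(1) in simp)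

lemma is_control_deriv:
  assumes "\<omega> > 0" "is_control \<omega> u"
  shows "t \<in> {0..2 * pi / \<omega>} \<Longrightarrow>
      (u has_real_derivative control_deriv \<omega> u t) (at t within {0..2 * pi / \<omega>})"
    and "continuous_on {0..2 * pi / \<omega>} (control_deriv \<omega> u)"
proof -
  obtain u' where u': "continuous_on {0..2 * pi / \<omega>} u'"
    "\<And>t. t \<in> {0..2 * pi / \<omega>} \<Longrightarrow> (u has_vector_derivative u' t) (at t within {0..2 * pi / \<omega>})"
    using assms(2) unfolding is_control_def by blast
  have eq: "control_deriv \<omega> u t = u' t" if "t \<in> {0..2 * pi / \<omega>}" for t
    using control_deriv_eq[OF assms(1) that u'(2)[OF that]] .
  show "t \<in> {0..2 * pi / \<omega>} \<Longrightarrow>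
      (u has_real_derivative control_deriv \<omega> u t) (at t within {0..2 * pi / \<omega>})"
    using u'(2) unfolding has_real_derivative_iff_has_vector_derivative by (simp only: eq)
  show "continuous_on {0..2 * pi / \<omega>} (control_deriv \<omega> u)"
    by (rule continuous_on_eq[OF u'(1)]) (simp add: eq)
qed

lemma is_control_integral_deriv:
  assumes "\<omega> > 0" "is_control \<omega> u"
  shows "(control_deriv \<omega> u has_integral 0) {0..2 * pi / \<omega>}"
proof -
  have "u (2 * pi / \<omega>) = u 0"
    using is_control_periodic[OF assms(2), of 0] by simp
  moreover have "(control_deriv \<omega> u has_integral u (2 * pi / \<omega>) - u 0) {0..2 * pi / \<omega>}"
  proof (rule fundamental_theorem_of_calculus)
    show "0 \<le> 2 * pi / \<omega>" using assms(1) by simp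
    show "(u has_vector_derivative control_deriv \<omega> u t) (at t within {0..2 * pi / \<omega>})"
      if "t \<in> {0..2 * pi / \<omega>}" for t
      using is_control_deriv(1)[OF assms that]
      by (simp only: has_real_derivative_iff_has_vector_derivative)
  qed
  ultimately show ?thesis by simp
qed

text \<open>The term of order \<open>\<epsilon>\<close> integrates a constant multiple of the
  control derivative over a full period, which gives 0.\<close>

lemma objective_eq:
  assumes pos: "\<gamma> > 0" "\<omega> > 0" "q0 > 0" and u: "is_control \<omega> u"
  shows "objective \<gamma> kB \<omega> q0 T0 T1 \<epsilon> u = - (\<omega> / (4 * pi)) * (\<epsilon>\<^sup>2 *
      integral {0..2 * pi / \<omega>} (\<lambda>t. control_deriv \<omega> u t * Sigma1 \<gamma> kB \<omega> q0 T0 T1 u t))"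
proof -
  let ?S = "Sigma1 \<gamma> kB \<omega> q0 T0 T1 u" and ?d = "control_deriv \<omega> u"
  have "continuous_on {0..2 * pi / \<omega>} ?S"
    by (rule has_real_derivative_imp_continuous_on, rule Sigma1_ode[OF pos u])
  then have int: "(\<lambda>t. ?d t * ?S t) integrable_on {0..2 * pi / \<omega>}"
    using is_control_deriv(2)[OF pos(2) u]
    by (intro integrable_continuous_real continuous_intros)
  have "((\<lambda>t. (\<epsilon> * (kB * T0 / q0)) * ?d t + \<epsilon>\<^sup>2 * (?d t * ?S t)) has_integral
      (\<epsilon> * (kB * T0 / q0)) * 0 + \<epsilon>\<^sup>2 * integral {0..2 * pi / \<omega>} (\<lambda>t. ?d t * ?S t)) {0..2 * pi / \<omega>}"
    by (intro has_integral_add has_integral_mult_right is_control_integral_deriv pos u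
          integrable_integral int)
  then show ?thesis
    unfolding objective_def Sigma0_eq[OF pos] by (simp add: integral_unique mult_ac)
qed

section \<open>The sinusoidal control: optimality and power\<close>

theorem theorem1:
  fixes \<gamma> kB \<omega> q0 T0 T1 g q1_opt \<phi>_opt :: real
    and u_opt :: "real \<Rightarrow> real"
  assumes "\<gamma> > 0" and "kB > 0" and "\<omega> > 0" and "q0 > 0"
    and "T0 > T1" and "T1 \<ge> 0"
    and "g = sqrt (\<gamma>\<^sup>2 * \<omega>\<^sup>2 + 4 * q0\<^sup>2)"
    and "q1_opt = q0 * g * T1 / (2 * \<gamma> * \<omega> * T0)"
    and "\<phi>_opt = Arg (of_real (\<gamma> * \<omega>) - \<i> * of_real (2 * q0))"
    and "u_opt = (\<lambda>t. q1_opt * cos (\<omega> * t - \<phi>_opt))"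
  shows "(\<forall>\<epsilon>>0. is_arg_max (objective \<gamma> kB \<omega> q0 T0 T1 \<epsilon>) (is_control \<omega>) u_opt) \<and>
         (\<lambda>\<epsilon>. power_output \<gamma> kB \<omega> q0 T0 T1 \<epsilon> u_opt
               - \<epsilon>\<^sup>2 * (kB * q0 * T1\<^sup>2 / (8 * \<gamma> * T0)))
           \<in> O[at_right 0](\<lambda>\<epsilon>. \<epsilon> ^ 3)"
proof -
  note pos = assms(1,3,4)
  define P where "P = 2 * pi / \<omega>"
  \<comment> \<open>Here \<open>a\<close> is the relaxation rate, \<open>s0\<close> the equilibrium
    variance, \<open>b = (2 / \<gamma>) * s0\<close> the coupling to the control and
    \<open>c\<close> the amplitude of the thermal forcing.\<close>
  define a b c s0 where "a = 2 * q0 / \<gamma>" and "b = 2 * kB * T0 / (\<gamma> * q0)"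
    and "c = 2 * kB * T1 / \<gamma>" and "s0 = kB * T0 / q0"
  define d where "d t = c / (2 * b) * (- \<omega> * sin (\<omega> * t) - a * cos (\<omega> * t))" for t
  \<comment> \<open>Adding the stationarity equation to the differentiated first-order equation
    cancels the control and leaves \<open>2 * S0'' = - c * \<omega> * sin (\<omega> * t)\<close>;
    this is the periodic solution of mean zero.\<close>
  define S0 where "S0 t = c / (2 * \<omega>) * sin (\<omega> * t)" for t
  have T0: "T0 > 0" using assms by simp
  have P: "P > 0" and b: "b > 0" using assms T0 by (auto simp: P_def b_def)
  have u_eq: "u_opt t = c / (2 * b) * (cos (\<omega> * t) - a / \<omega> * sin (\<omega> * t))" for t
  proof -
    define z where "z = of_real (\<gamma> * \<omega>) - \<i> * of_real (2 * q0)"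
    have z: "Re z = \<gamma> * \<omega>" "Im z = - 2 * q0" by (simp_all add: z_def)
    have "cmod z = g"
      unfolding cmod_def z assms(7) by (simp add: power_mult_distrib)
    \<comment> \<open>The polar form of \<open>z\<close> has modulus \<open>g\<close> and angle
      \<open>\<phi>_opt\<close>, so its real and imaginary parts convert the phase form of the
      control to cosine and sine components.\<close>
    then have "g * cos \<phi>_opt = \<gamma> * \<omega>" "g * sin \<phi>_opt = - 2 * q0"
      unfolding assms(9) z_def[symmetric] using z
      by (metis Re_rcis rcis_cmod_Arg, metis Im_rcis rcis_cmod_Arg)
    then have "g * cos (\<omega> * t - \<phi>_opt) = \<gamma> * \<omega> * cos (\<omega> * t) - 2 * q0 * sin (\<omega> * t)"
      unfolding cos_diff by algebra
    then have "u_opt t = q0 * T1 / (2 * \<gamma> * \<omega> * T0) * (\<gamma> * \<omega> * cos (\<omega> * t) - 2 * q0 * sin (\<omega> * t))"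
      unfolding assms(10,8) by simp
    also have "\<dots> = c / (2 * b) * (cos (\<omega> * t) - a / \<omega> * sin (\<omega> * t))"
      unfolding a_def b_def c_def using assms T0 by (simp add: field_simps)
    finally show ?thesis .
  qed
  have u_der: "(u_opt has_real_derivative d t) (at t)" for t
    unfolding u_eq[abs_def] d_def using pos b
    by (auto intro!: derivative_eq_intros simp: algebra_simps)
  have d_cont: "continuous_on A d" for A
    unfolding d_def by (intro continuous_intros)
  have u_per: "u_opt (t + P) = u_opt t" and S0_per: "S0 (t + P) = S0 t" for t
    unfolding u_eq S0_def P_def using pos by (simp_all add: cos_period_shift)
  have ctrl: "is_control \<omega> u_opt"
    by (rule is_controlI[OF u_per[unfolded P_def] u_der d_cont])
  have d_eq: "control_deriv \<omega> u_opt t = d t" if "t \<in> {0..P}" for t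
  proof (rule control_deriv_eq[OF pos(2) that[unfolded P_def]])
    show "(u_opt has_vector_derivative d t) (at t within {0..2 * pi / \<omega>})"
      using u_der[of t] has_vector_derivative_at_within
      unfolding has_real_derivative_iff_has_vector_derivative by blast
  qed
  have S0_der: "(S0 has_real_derivative c / 2 * cos (\<omega> * t)) (at t)" for t
    unfolding S0_def using pos by (auto intro!: derivative_eq_intros)
  have S0_ode: "c / 2 * cos (\<omega> * t) = - a * S0 t - b * u_opt t + c * cos (\<omega> * t)" for t
    unfolding S0_def u_eq using pos b by (simp add: field_simps)
  have S1_opt: "Sigma1 \<gamma> kB \<omega> q0 T0 T1 u_opt = S0"
  proof (rule Sigma1_solution(2)[OF pos ctrl refl, where kB = kB and ?T0.0 = T0 and ?T1.0 = T1,
        folded a_def b_def c_def P_def])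
    have eq: "- a * S0 t + (- b * u_opt t + c * cos (\<omega> * t)) = c / 2 * cos (\<omega> * t)" for t
      using S0_ode[of t] by simp
    show "is_periodic_solution P
        (\<lambda>t s. - a * s + (- b * u_opt t + c * cos (\<omega> * t))) S0"
      unfolding is_periodic_solution_def eq using S0_der S0_per by blast
  qed

  \<comment> \<open>Optimality among all controls\<close>
  have opt: "is_arg_max (objective \<gamma> kB \<omega> q0 T0 T1 \<epsilon>) (is_control \<omega>) u_opt" for \<epsilon>
    unfolding is_arg_max_def
  proof (intro conjI ctrl notI, elim exE conjE)
    fix u assume u: "is_control \<omega> u"
      and less: "objective \<gamma> kB \<omega> q0 T0 T1 \<epsilon> u_opt < objective \<gamma> kB \<omega> q0 T0 T1 \<epsilon> u"
    let ?S = "Sigma1 \<gamma> kB \<omega> q0 T0 T1 u"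
    note S = Sigma1_ode[OF pos u, of kB T0 T1, folded a_def b_def c_def P_def]
    have "integral {0..P} (\<lambda>t. d t * S0 t) \<le> integral {0..P} (\<lambda>t. control_deriv \<omega> u t * ?S t)"
    proof (rule linear_response_work_minimal[OF P b _ u_der d_cont _ S0_der S0_ode])
      show "(u has_real_derivative control_deriv \<omega> u t) (at t within {0..P})" if "t \<in> {0..P}" for t
        using is_control_deriv(1)[OF pos(2) u] that unfolding P_def .
      show "(?S has_real_derivative - a * ?S t - b * u t + c * cos (\<omega> * t)) (at t)" for t
        using S(1)[of t] by (simp add: algebra_simps)
      show "((\<lambda>t. c / 2 * cos (\<omega> * t)) has_real_derivative a * (c / 2 * cos (\<omega> * t)) + b * d t) (at t)"
        for t
        unfolding d_def using b by (auto intro!: derivative_eq_intros simp: field_simps)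
      show "u P = u 0" using is_control_periodic[OF u, of 0] by (simp add: P_def)
      show "u_opt P = u_opt 0" using u_per[of 0] by simp
      show "S0 P = S0 0" using S0_per[of 0] by simp
      show "?S P = ?S 0" using S(2)[of 0] by simp
      show "c / 2 * cos (\<omega> * P) = c / 2 * cos (\<omega> * 0)"
        unfolding P_def using pos by simp
    qed
    also have "integral {0..P} (\<lambda>t. d t * S0 t) = integral {0..P} (\<lambda>t. control_deriv \<omega> u_opt t * S0 t)"
      by (rule integral_cong) (simp add: d_eq)
    \<comment> \<open>The factor \<open>- (\<omega> / (4 * pi))\<close> reverses the inequality, and
      the square of \<open>\<epsilon>\<close> preserves it.\<close>
    finally have "objective \<gamma> kB \<omega> q0 T0 T1 \<epsilon> u \<le> objective \<gamma> kB \<omega> q0 T0 T1 \<epsilon> u_opt"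
      unfolding objective_eq[OF pos u] objective_eq[OF pos ctrl] S1_opt P_def[symmetric]
      using pos by (intro mult_left_mono_neg mult_left_mono) auto
    then show False using less by simp
  qed

  \<comment> \<open>Asymptotics of the power with the exact variance\<close>
  define M where "M = \<bar>q1_opt\<bar> * (\<bar>c\<bar> / (2 * \<omega>))"
  define X where "X = kB * q0 * T1\<^sup>2 / (8 * \<gamma> * T0)"
  \<comment> \<open>The factors are the prefactor of the power, a bound on the control derivative,
    the constant in the quadratic remainder bound, and the length of the period.\<close>
  define K where "K = \<omega> / (4 * pi) * (\<bar>q1_opt\<bar> * \<omega> * (2 * M / q0) * P)"
  have u_bound: "\<bar>u_opt t\<bar> \<le> \<bar>q1_opt\<bar>" for t
    unfolding assms(10) by (simp add: abs_mult mult_left_le)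
  have S0_bound: "\<bar>S0 t\<bar> \<le> \<bar>c\<bar> / (2 * \<omega>)" for t
    unfolding S0_def using pos by (simp add: abs_mult divide_right_mono mult_left_le)
  have d_bound: "\<bar>d t\<bar> \<le> \<bar>q1_opt\<bar> * \<omega>" for t
  proof -
    have "(u_opt has_real_derivative - q1_opt * \<omega> * sin (\<omega> * t - \<phi>_opt)) (at t)"
      unfolding assms(10) by (auto intro!: derivative_eq_intros)
    then have "d t = - q1_opt * \<omega> * sin (\<omega> * t - \<phi>_opt)"
      using u_der DERIV_unique by blast
    then show ?thesis using pos by (simp add: abs_mult mult_left_le)
  qed
  have dS0: "((\<lambda>t. d t * S0 t) has_integral - (c\<^sup>2 / (8 * b) * P)) {0..P}"
  proof -
    \<comment> \<open>\<open>H\<close> integrates the squared sine and the mixed sine-cosine product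
      in \<open>d t * S0 t\<close> explicitly; over a period only its term linear in
      \<open>t\<close> contributes.\<close>
    define H where "H t = - (c\<^sup>2 / (8 * b)) * (t - sin (\<omega> * t) * cos (\<omega> * t) / \<omega>)
        - a * c\<^sup>2 / (8 * b * \<omega>\<^sup>2) * (sin (\<omega> * t) * sin (\<omega> * t))" for t
    have "(H has_real_derivative d t * S0 t) (at t)" for t
    proof -
      let ?s = "sin (\<omega> * t)" and ?c = "cos (\<omega> * t)"
      have "((\<lambda>t. sin (\<omega> * t) * cos (\<omega> * t) / \<omega>) has_real_derivative ?c * ?c - ?s * ?s) (at t)"
        "((\<lambda>t. sin (\<omega> * t) * sin (\<omega> * t)) has_real_derivative 2 * \<omega> * (?s * ?c)) (at t)"
        using pos by (auto intro!: derivative_eq_intros simp: field_simps)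
      then have "(H has_real_derivative - (c\<^sup>2 / (8 * b)) * (1 - (?c * ?c - ?s * ?s))
          - a * c\<^sup>2 / (8 * b * \<omega>\<^sup>2) * (2 * \<omega> * (?s * ?c))) (at t)"
        unfolding H_def by (intro DERIV_diff DERIV_cmult DERIV_ident)
      moreover have "1 - (?c * ?c - ?s * ?s) = 2 * (?s * ?s)"
        using sin_cos_squared_add3[of "\<omega> * t"] by linarith
      moreover have "d t * S0 t = - (c\<^sup>2 / (8 * b)) * (2 * (?s * ?s))
          - a * c\<^sup>2 / (8 * b * \<omega>\<^sup>2) * (2 * \<omega> * (?s * ?c))"
        unfolding d_def S0_def using pos b by (simp add: field_simps power2_eq_square)
      ultimately show ?thesis by simp
    qed
    then have "((\<lambda>t. d t * S0 t) has_integral H P - H 0) {0..P}"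
      using P by (intro fundamental_theorem_of_calculus)
        (auto simp: has_real_derivative_iff_has_vector_derivative[symmetric]
           intro: has_field_derivative_at_within)
    moreover have "\<omega> * P = 2 * pi" using pos by (simp add: P_def)
    then have "H P - H 0 = - (c\<^sup>2 / (8 * b) * P)"
      unfolding H_def by simp
    ultimately show ?thesis by simp
  qed
  have X_eq: "\<omega> / (4 * pi) * (c\<^sup>2 / (8 * b) * P) = X"
    unfolding X_def P_def c_def b_def using assms T0 by (simp add: field_simps power2_eq_square)
  have d_int: "(d has_integral 0) {0..P}"
    using is_control_integral_deriv[OF pos(2) ctrl, folded P_def]
    by (rule has_integral_eq[rotated]) (rule d_eq)

  have bound: "\<bar>power_output \<gamma> kB \<omega> q0 T0 T1 \<epsilon> u_opt - \<epsilon>\<^sup>2 * X\<bar> \<le> K * \<epsilon> ^ 3"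
    if \<epsilon>: "0 < \<epsilon>" and small: "\<epsilon> * \<bar>q1_opt\<bar> \<le> q0 / 2" for \<epsilon>
  proof -
    define \<alpha> where "\<alpha> t = (2 / \<gamma>) * (q0 + \<epsilon> * u_opt t)" for t
    define \<beta> where "\<beta> t = (2 / \<gamma>) * kB * temperature \<omega> T0 T1 \<epsilon> t" for t
    define V where "V = variance_cyclic \<gamma> kB \<omega> q0 T0 T1 \<epsilon> u_opt"
    \<comment> \<open>Smallness of \<open>\<epsilon>\<close> keeps the gain above
      \<open>q0 / 2\<close>, so the relaxation rate stays positive uniformly in
      \<open>\<epsilon>\<close>.\<close>
    have \<alpha>: "\<alpha> t \<ge> q0 / \<gamma>" for t
    proof -
      have "\<epsilon> * \<bar>u_opt t\<bar> \<le> \<epsilon> * \<bar>q1_opt\<bar>"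
        using \<epsilon> u_bound by (intro mult_left_mono) auto
      also note small
      finally have "\<bar>\<epsilon> * u_opt t\<bar> \<le> q0 / 2" using \<epsilon> by (simp add: abs_mult)
      then have "(2 / \<gamma>) * (q0 / 2) \<le> \<alpha> t"
        unfolding \<alpha>_def using pos by (intro mult_left_mono) auto
      then show ?thesis by simp
    qed
    have \<alpha>pos: "\<alpha> t > 0" for t using \<alpha>[of t] pos by (meson divide_pos_pos less_le_trans)
    have \<alpha>cont: "continuous_on UNIV \<alpha>" and \<beta>cont: "continuous_on UNIV \<beta>"
      unfolding \<alpha>_def \<beta>_def temperature_def
      by (intro continuous_intros is_control_continuous[OF pos(2) ctrl])+
    have \<alpha>per: "\<alpha> (t + P) = \<alpha> t" and \<beta>per: "\<beta> (t + P) = \<beta> t" for t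
      unfolding \<alpha>_def \<beta>_def temperature_def u_per
      using pos by (simp_all add: P_def cos_period_shift)
    have V: "is_periodic_solution P (\<lambda>t s. - \<alpha> t * s + \<beta> t) V"
    proof -
      have "(\<lambda>t s. - (2 / \<gamma>) * (q0 + \<epsilon> * u_opt t) * s + (2 / \<gamma>) * kB * temperature \<omega> T0 T1 \<epsilon> t)
          = (\<lambda>t s. - \<alpha> t * s + \<beta> t)"
        by (simp add: \<alpha>_def \<beta>_def)
      then have "V = periodic_solution P (\<lambda>t s. - \<alpha> t * s + \<beta> t)"
        unfolding V_def variance_cyclic_def P_def by simp
      then show ?thesis
        using periodic_solution_linear(1)[OF P \<alpha>cont \<beta>cont \<alpha>per \<beta>per \<alpha>pos refl] by simp
    qed
    define R where "R t = V t - s0 - \<epsilon> * S0 t" for t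
    \<comment> \<open>Inserting \<open>s0 + \<epsilon> * S0 t\<close> into the exact equation
      cancels orders zero and one; the product of the control with \<open>S0\<close> is all that
      remains.\<close>
    define r where "r t = - (2 / \<gamma>) * \<epsilon>\<^sup>2 * (u_opt t * S0 t)" for t
    have R_der: "(R has_real_derivative - \<alpha> t * R t + r t) (at t)" for t
    proof -
      have "(R has_real_derivative - \<alpha> t * V t + \<beta> t - \<epsilon> * (c / 2 * cos (\<omega> * t))) (at t)"
        unfolding R_def using V unfolding is_periodic_solution_def
        by (auto intro!: derivative_eq_intros S0_der)
      moreover have "\<beta> t - \<epsilon> * (c / 2 * cos (\<omega> * t)) = \<alpha> t * (s0 + \<epsilon> * S0 t) + r t"
      proof -
        have "c / 2 * cos (\<omega> * t) = a * S0 t + b * u_opt t"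
          using S0_ode[of t] by simp
        moreover have "\<beta> t = a * s0 + \<epsilon> * (c * cos (\<omega> * t))"
          unfolding \<beta>_def temperature_def a_def s0_def c_def using pos by (simp add: field_simps)
        moreover have "\<alpha> t = a + \<epsilon> * (2 / \<gamma>) * u_opt t" "(2 / \<gamma>) * s0 = b"
          unfolding \<alpha>_def a_def s0_def b_def by (simp_all add: algebra_simps)
        ultimately show ?thesis
          unfolding r_def by algebra
      qed
      ultimately show ?thesis
        by (simp add: R_def algebra_simps)
    qed
    have R_per: "R (t + P) = R t" for t
      using V S0_per unfolding R_def is_periodic_solution_def by simp
    have r_bound: "\<bar>r t\<bar> \<le> (2 / \<gamma>) * \<epsilon>\<^sup>2 * M" for t
    proof -
      have "\<bar>u_opt t * S0 t\<bar> \<le> M"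
        unfolding M_def abs_mult using u_bound S0_bound by (intro mult_mono) auto
      then show ?thesis
        unfolding r_def using pos by (simp add: abs_mult mult_left_mono divide_right_mono)
    qed
    have R_bound: "\<bar>R t\<bar> \<le> 2 * M / q0 * \<epsilon>\<^sup>2" for t
      using periodic_linear_ode_bound[OF P _ R_der R_per \<alpha> r_bound, of t] pos
      by (simp add: field_simps)
    have "continuous_on {0..P} R"
      using R_der by (rule has_real_derivative_imp_continuous_on)
    then have dR_int: "(\<lambda>t. d t * R t) integrable_on {0..P}"
      by (intro integrable_continuous_real continuous_intros d_cont)
    define I where "I = integral {0..P} (\<lambda>t. d t * R t)"
    have dR: "((\<lambda>t. d t * R t) has_integral I) {0..P}"
      unfolding I_def using dR_int by (rule integrable_integral)
    have "\<bar>I\<bar> \<le> (\<bar>q1_opt\<bar> * \<omega>) * (2 * M / q0 * \<epsilon>\<^sup>2) * P"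
    proof -
      have "norm (d t * R t) \<le> (\<bar>q1_opt\<bar> * \<omega>) * (2 * M / q0 * \<epsilon>\<^sup>2)" for t
        unfolding real_norm_def abs_mult using d_bound R_bound pos by (intro mult_mono) auto
      moreover from this[of 0] have "0 \<le> (\<bar>q1_opt\<bar> * \<omega>) * (2 * M / q0 * \<epsilon>\<^sup>2)"
        by (rule order_trans[OF norm_ge_zero])
      ultimately show ?thesis
        using has_integral_bound_real[OF _ _ dR, of "(\<bar>q1_opt\<bar> * \<omega>) * (2 * M / q0 * \<epsilon>\<^sup>2)" "{}"] P
        by simp
    qed
    then have I_bound: "\<omega> / (4 * pi) * (\<epsilon> * \<bar>I\<bar>) \<le> K * \<epsilon> ^ 3"
    proof -
      assume *: "\<bar>I\<bar> \<le> (\<bar>q1_opt\<bar> * \<omega>) * (2 * M / q0 * \<epsilon>\<^sup>2) * P"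
      have "\<omega> / (4 * pi) * (\<epsilon> * \<bar>I\<bar>)
          \<le> \<omega> / (4 * pi) * (\<epsilon> * ((\<bar>q1_opt\<bar> * \<omega>) * (2 * M / q0 * \<epsilon>\<^sup>2) * P))"
        using pos \<epsilon> by (intro mult_left_mono *) auto
      also have "\<dots> = K * \<epsilon> ^ 3"
        unfolding K_def by (simp add: power2_eq_square power3_eq_cube)
      finally show ?thesis .
    qed
    \<comment> \<open>Of the three parts of the variance, the constant contributes nothing,
      \<open>S0\<close> yields the leading term, and \<open>R\<close> an error of third
      order.\<close>
    have "((\<lambda>t. (\<epsilon> * s0) * d t + \<epsilon>\<^sup>2 * (d t * S0 t) + \<epsilon> * (d t * R t)) has_integral
        (\<epsilon> * s0) * 0 + \<epsilon>\<^sup>2 * (- (c\<^sup>2 / (8 * b) * P)) + \<epsilon> * I) {0..P}"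
      by (intro has_integral_add has_integral_mult_right d_int dS0 dR)
    also have "?this \<longleftrightarrow> ((\<lambda>t. \<epsilon> * control_deriv \<omega> u_opt t * V t) has_integral
        (\<epsilon> * s0) * 0 + \<epsilon>\<^sup>2 * (- (c\<^sup>2 / (8 * b) * P)) + \<epsilon> * I) {0..P}"
      by (rule has_integral_cong) (simp add: d_eq R_def power2_eq_square algebra_simps)
    finally have int_eq: "integral {0..P} (\<lambda>t. \<epsilon> * control_deriv \<omega> u_opt t * V t)
        = (\<epsilon> * s0) * 0 + \<epsilon>\<^sup>2 * (- (c\<^sup>2 / (8 * b) * P)) + \<epsilon> * I"
      by (rule integral_unique)
    have "power_output \<gamma> kB \<omega> q0 T0 T1 \<epsilon> u_opt
        = \<epsilon>\<^sup>2 * (\<omega> / (4 * pi) * (c\<^sup>2 / (8 * b) * P)) - \<omega> / (4 * pi) * (\<epsilon> * I)"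
      unfolding power_output_def V_def[symmetric] P_def[symmetric] int_eq
      by (simp add: algebra_simps)
    then have "\<bar>power_output \<gamma> kB \<omega> q0 T0 T1 \<epsilon> u_opt - \<epsilon>\<^sup>2 * X\<bar> = \<omega> / (4 * pi) * (\<epsilon> * \<bar>I\<bar>)"
      unfolding X_eq using pos \<epsilon> by (simp add: abs_mult)
    then show ?thesis using I_bound by simp
  qed
  \<comment> \<open>The summand 1 keeps the denominator positive when \<open>T1 = 0\<close>, where
    \<open>q1_opt\<close> vanishes.\<close>
  have "eventually (\<lambda>\<epsilon>. \<epsilon> \<in> {0<..<q0 / (2 * (\<bar>q1_opt\<bar> + 1))}) (at_right 0)"
    by (rule eventually_at_right_real) (use pos in \<open>simp add: field_simps add_pos_nonneg\<close>)
  then have "eventually (\<lambda>\<epsilon>. norm (power_output \<gamma> kB \<omega> q0 T0 T1 \<epsilon> u_opt - \<epsilon>\<^sup>2 * X)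
      \<le> K * norm (\<epsilon> ^ 3)) (at_right 0)"
  proof (rule eventually_mono)
    fix \<epsilon> assume \<epsilon>: "\<epsilon> \<in> {0<..<q0 / (2 * (\<bar>q1_opt\<bar> + 1))}"
    then have "\<epsilon> * (\<bar>q1_opt\<bar> + 1) < q0 / 2"
      by (simp add: pos_less_divide_eq add_nonneg_pos algebra_simps)
    then have "\<epsilon> * \<bar>q1_opt\<bar> \<le> q0 / 2" using \<epsilon> by (simp add: algebra_simps)
    then show "norm (power_output \<gamma> kB \<omega> q0 T0 T1 \<epsilon> u_opt - \<epsilon>\<^sup>2 * X) \<le> K * norm (\<epsilon> ^ 3)"
      using bound[of \<epsilon>] \<epsilon> by simp
  qed
  then have "(\<lambda>\<epsilon>. power_output \<gamma> kB \<omega> q0 T0 T1 \<epsilon> u_opt - \<epsilon>\<^sup>2 * X) \<in> O[at_right 0](\<lambda>\<epsilon>. \<epsilon> ^ 3)"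
    by (rule bigoI)
  then show ?thesis using opt unfolding X_def by blast
qed

end
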